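(* Let $G=(Q,\Sigma,\delta,i)$ be a deterministic discrete-event system with projection $P\colon\Sigma^*\to\Sigma_o^*$, let $Q_S\subseteq Q$, and let $k\in\mathbb{N}\cup\{\infty\}$. If $G$ is strongly $k$-step opaque with respect to $Q_S$ and $P$, then $G$ is weakly $k$-step opaque with respect to $Q_S$ (secret states), $Q-Q_S$ (nonsecret states) and $P$.
   Context: A deterministic discrete-event system (DES) $G=(Q,\Sigma,\delta,i)$ is a deterministic finite automaton with finite state set $Q$, finite nonempty alphabet $\Sigma$ partitioned into observable events $\Sigma_o$ and unobservable events $\Sigma_{uo}$, initial state $i$, and partial transition function $\delta\colon Q\times\Sigma\to Q$, extended to strings as usual. $L(G)$ is the set of all $w\in\Sigma^*$ for which $\delta(i,w)$ is defined. The projection $P\colon\Sigma^*\to\Sigma_o^*$ is the monoid morphism erasing the unobservable events and fixing the observable ones. Strong $k$-step opacity: $G$ is strongly $k$-step opaque with respect to the set $Q_S$ of secret states and $P$ if for every $s\in L(G)$ there is $w\in L(G)$ such that $P(s)=P(w)$ and, for every prefix $w'$ of $w$, if $|P(w)|-|P(w')|\le k$, then $\delta(i,w')\notin Q_S$. Weak $k$-step opacity (for a deterministic DES): $G$ is weakly $k$-step opaque with respect to sets $Q_S,Q_{NS}\subseteq Q$ of secret and nonsecret states and $P$ if for every string $st\in L(G)$ with $|P(t)|\le k$ and $\delta(i,s)\in Q_S$, there is a string $s't'\in L(G)$ such that $P(s)=P(s')$, $P(t)=P(t')$ and $\delta(i,s')\in Q_{NS}$. *)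

theory Defs
  imports Main "HOL-Library.Extended_Nat" "HOL-Library.Sublist"
begin

record ('q, 'a) des =
  states :: "'q set"
  observable :: "'a set"
  unobservable :: "'a set"
  trans_fun :: "'q \<Rightarrow> 'a \<Rightarrow> 'q option"
  init_state :: "'q"

definition alphabet :: "('q, 'a) des \<Rightarrow> 'a set" where
  "alphabet G = observable G \<union> unobservable G"

text \<open>The last conjunct says that the transition function is a partial function from
  \<open>states G \<times> alphabet G\<close> to \<open>states G\<close>; the value \<open>None\<close> stands for undefined.\<close>

definition deterministic_des :: "('q, 'a) des \<Rightarrow> bool" where
  "deterministic_des G \<longleftrightarrow>
     finite (states G) \<and>
     finite (alphabet G) \<and> alphabet G \<noteq> {} \<and>
     observable G \<inter> unobservable G = {} \<and>
     init_state G \<in> states G \<and>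
     (\<forall>q a q'. trans_fun G q a = Some q' \<longrightarrow>
        q \<in> states G \<and> a \<in> alphabet G \<and> q' \<in> states G)"

primrec trans_ext :: "('q, 'a) des \<Rightarrow> 'q \<Rightarrow> 'a list \<Rightarrow> 'q option" where
  "trans_ext G q [] = Some q"
| "trans_ext G q (a # w) = Option.bind (trans_fun G q a) (\<lambda>q'. trans_ext G q' w)"

definition lang :: "('q, 'a) des \<Rightarrow> 'a list set" where
  "lang G = {w \<in> lists (alphabet G). trans_ext G (init_state G) w \<noteq> None}"

definition proj :: "('q, 'a) des \<Rightarrow> 'a list \<Rightarrow> 'a list" where
  "proj G w = filter (\<lambda>a. a \<in> observable G) w"

text \<open>Membership of the (possibly undefined) state reached by a string in a set \<open>X\<close> of states
  is written as membership in \<open>Some ` X\<close>. The strings concerned below are all prefixes of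
  strings of the language, so the state reached is always defined. Likewise the subtraction on
  natural numbers does not truncate, since \<open>w'\<close> is a prefix of \<open>w\<close>.\<close>

definition strongly_k_step_opaque ::
  "('q, 'a) des \<Rightarrow> 'q set \<Rightarrow> enat \<Rightarrow> bool" where
  "strongly_k_step_opaque G QS k \<longleftrightarrow>
     (\<forall>s \<in> lang G. \<exists>w \<in> lang G. proj G s = proj G w \<and>
        (\<forall>w'. prefix w' w \<longrightarrow>
           enat (length (proj G w) - length (proj G w')) \<le> k \<longrightarrow>
           trans_ext G (init_state G) w' \<notin> Some ` QS))"

definition weakly_k_step_opaque ::
  "('q, 'a) des \<Rightarrow> 'q set \<Rightarrow> 'q set \<Rightarrow> enat \<Rightarrow> bool" where
  "weakly_k_step_opaque G QS QNS k \<longleftrightarrow>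
     (\<forall>s t. s @ t \<in> lang G \<longrightarrow> enat (length (proj G t)) \<le> k \<longrightarrow>
        trans_ext G (init_state G) s \<in> Some ` QS \<longrightarrow>
        (\<exists>s' t'. s' @ t' \<in> lang G \<and> proj G s = proj G s' \<and> proj G t = proj G t' \<and>
           trans_ext G (init_state G) s' \<in> Some ` QNS))"

end

theory Submission
  imports Defs
begin

text \<open>Strong opacity is applied to the whole string \<open>s @ t\<close>, not to
  \<open>s\<close> alone: it yields \<open>w\<close> in the language with projection P(s)P(t). A
  word whose projection factors in this way can itself be cut accordingly
  (\<open>filter_eq_appendE\<close>), so w = s't' with P(s') = P(s) and P(t') = P(t). Only |P(t)|
  \<le> k observable events of \<open>w\<close> come after the prefix s', hence strong opacity
  forbids that s' leads to a secret state.\<close>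

text \<open>Induction on \<open>u\<close>: its head is the first kept element of \<open>w\<close>,
  and the cut is made in what follows. It thus falls right after the last element kept for
  \<open>u\<close> (at the start if \<open>u\<close> is empty), and dropped elements at the border
  go to \<open>y\<close>.\<close>

lemma filter_eq_appendE:
  assumes "filter P w = u @ v"
  obtains x y where "w = x @ y" "filter P x = u" "filter P y = v"
proof -
  have "\<exists>x y. w = x @ y \<and> filter P x = u \<and> filter P y = v"
    using assms
  proof (induction u arbitrary: w)
    case Nil
    then show ?case by (intro exI[of _ "[]"] exI[of _ w]) simp
  next
    case (Cons a u)
    then obtain us vs where w: "w = us @ a # vs" "\<forall>b\<in>set us. \<not> P b" "P a"
      "u @ v = filter P vs"
      by (auto simp: filter_eq_Cons_iff)
    with Cons.IH[of vs] obtain x y where "vs = x @ y" "filter P x = u" "filter P y = v"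
      by metis
    with w show ?case
      by (intro exI[of _ "us @ a # x"] exI[of _ y]) (simp add: filter_empty_conv)
  qed
  then show thesis using that by blast
qed

lemma trans_ext_append:
  "trans_ext G q (u @ v) = Option.bind (trans_ext G q u) (\<lambda>q'. trans_ext G q' v)"
  by (induction u arbitrary: q) (auto split: Option.bind_splits)

lemma trans_ext_in_states:
  assumes "deterministic_des G" "q \<in> states G" "trans_ext G q w = Some q'"
  shows "q' \<in> states G"
  using assms(2,3)
proof (induction w arbitrary: q)
  case (Cons a w)
  then obtain p where "trans_fun G q a = Some p" "trans_ext G p w = Some q'"
    by (auto split: Option.bind_splits)
  moreover from this have "p \<in> states G"
    using assms(1) by (simp add: deterministic_des_def)
  ultimately show ?case using Cons.IH by blast
qed simp

theorem theorem15:
  fixes G :: "('q, 'a) des" and QS :: "'q set" and k :: enat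
  assumes "deterministic_des G"
    and "QS \<subseteq> states G"
    and "strongly_k_step_opaque G QS k"
  shows "weakly_k_step_opaque G QS (states G - QS) k"
  unfolding weakly_k_step_opaque_def
proof (intro allI impI)
  fix s t
  assume st: "s @ t \<in> lang G" and k: "enat (length (proj G t)) \<le> k"
  obtain w where w: "w \<in> lang G" "proj G (s @ t) = proj G w"
    and ns: "\<And>w'. prefix w' w \<Longrightarrow> enat (length (proj G w) - length (proj G w')) \<le> k
      \<Longrightarrow> trans_ext G (init_state G) w' \<notin> Some ` QS"
    using assms(3) st unfolding strongly_k_step_opaque_def by blast
  have "filter (\<lambda>a. a \<in> observable G) w = proj G s @ proj G t"
    using w(2) by (simp add: proj_def)
  then obtain s' t' where split: "w = s' @ t'" "proj G s' = proj G s" "proj G t' = proj G t"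
    unfolding proj_def by (rule filter_eq_appendE)
  \<comment> \<open>A run on \<open>w\<close> passes through a state after its prefix
    \<open>s'\<close>.\<close>
  obtain q where q: "trans_ext G (init_state G) s' = Some q"
    using w(1) by (auto simp: split(1) lang_def trans_ext_append split: Option.bind_splits)
  \<comment> \<open>This turns the bound on \<open>t\<close> into the premise of \<open>ns\<close>
    for the prefix \<open>s'\<close>.\<close>
  have "length (proj G w) - length (proj G s') = length (proj G t)"
    using split w(2) by (simp add: proj_def)
  with k ns[of s'] q split(1) have "q \<notin> QS" by auto
  \<comment> \<open>Nonsecret means lying in the complement of \<open>QS\<close> within
    \<open>states G\<close>, so avoiding \<open>QS\<close> is not enough.\<close>
  moreover have "q \<in> states G"
    using assms(1) trans_ext_in_states[OF assms(1) _ q] by (simp add: deterministic_des_def)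
  ultimately show "\<exists>s' t'. s' @ t' \<in> lang G \<and> proj G s = proj G s' \<and> proj G t = proj G t' \<and>
      trans_ext G (init_state G) s' \<in> Some ` (states G - QS)"
    using w(1) split q by (intro exI[of _ s'] exI[of _ t']) auto
qed

end
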